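(* Let $\ell\ge 2$, let $\beta>0$, and let $\mathcal{K}_j$, $\mathcal{G}_j$, $\mathcal{W}_j$ ($0\le j\le \ell-1$), $\mathcal{S}_j,\mathcal{P}_j,\Pi_j$ ($0\le j\le \ell-2$) be the operators on the nested spaces $Y_j$, $U_j$ defined in the context. Assume there is a constant $C_{\mathcal K}>0$ such that $\|\mathcal{K}_j\|\le C_{\mathcal K}$ for all $j=0,1,\dots,\ell-1$, and set $$a_j=\|\mathcal{K}_j-\mathcal{S}_j\mathcal{K}_{j+1}\Pi_j\|,\qquad b_j=4\beta^{-1}C_{\mathcal K}\,a_j,\qquad j=0,1,\dots,\ell-2 .$$ Suppose there are real numbers $\mathfrak{f}$ and $\mathfrak{K}$ with $0<\mathfrak{f}\le 1$ and $\mathfrak{K}\le \min(0.1,\ \mathfrak{f}/8)$ such that $$b_j\le \mathfrak{K}\,\mathfrak{f}^{\,\ell-1-j},\qquad j=0,1,\dots,\ell-2 .$$ Then $$d_\sigma(\mathcal{W}_0,\mathcal{G}_0^{-1})\le\left(\tfrac14+\mathfrak{K}\right)\mathfrak{f}^{\,\ell-1}.$$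
   Context: Setting. $\Omega\subset\mathbb{R}^d$ ($d=2,3$) is a sufficiently regular bounded domain; $(\cdot,\cdot)$ and $\|\cdot\|$ are the real $L^2(\Omega)$ inner product and norm. The coefficient $\kappa:\Omega\to\mathbb{R}$ satisfies $0<\kappa_0\le\kappa(x)\le\kappa_1<\infty$ for all $x \in \Omega$, and $a(y,v)=\int_\Omega\kappa\nabla y\cdot\nabla v$ for $y,v\in H_0^1(\Omega)$. There are nested finite-dimensional nonzero spaces (numbered from finest to coarsest) $Y_0\supseteq Y_1\supseteq\dots\supseteq Y_{\ell-1}$ in $H_0^1(\Omega)$ (state spaces) and $U_0\supseteq U_1\supseteq\dots\supseteq U_{\ell-1}$ in $L^2(\Omega)$ (control spaces), all equipped with the $L^2(\Omega)$ inner product. $\mathfrak{L}(X,Z)$ denotes linear maps $X\to Z$, and $\mathfrak{L}(X)=\mathfrak{L}(X,X)$. Operators. $\mathcal{S}_j\in\mathfrak{L}(Y_{j+1},Y_j)$ and $\mathcal{P}_j\in\mathfrak{L}(U_{j+1},U_j)$ are the inclusions; $\Pi_j=\mathcal{P}_j^*\in\mathfrak{L}(U_j,U_{j+1})$ is the $L^2$-orthogonal projection. The solution operator $\mathcal{K}_j\in\mathfrak{L}(U_j,Y_j)$ is defined by: $\mathcal{K}_ju=y$ where $y\in Y_j$ satisfies $a(y,v)=(u,v)$ for all $v\in Y_j$. With $\beta>0$ the regularization parameter, $\mathcal{G}_j=\mathcal{K}_j^*\mathcal{K}_j+\beta I\in\mathfrak{L}(U_j)$ (adjoint with respect to the $L^2$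 inner product). For an operator $\mathcal{L}$ between subspaces of $L^2(\Omega)$, $\|\mathcal{L}\|=\sup_{u\ne0}\|\mathcal{L}u\|/\|u\|$. Multilevel preconditioner. For $\mathcal{X},\mathcal{Y}\in\mathfrak{L}(U)$ let $\mathcal{N}_{\mathcal X}(\mathcal Y)=2\mathcal{Y}-\mathcal{Y}\mathcal{X}\mathcal{Y}$. Define $\mathcal{E}_j:\mathfrak{L}(U_{j+1})\to\mathfrak{L}(U_j)$ by $\mathcal{E}_j(\mathcal{X})=\mathcal{P}_j\mathcal{X}\Pi_j+\beta^{-1}(I-\mathcal{P}_j\Pi_j)$. Then recursively: $\mathcal{W}_{\ell-1}=\mathcal{G}_{\ell-1}^{-1}$; $\mathcal{W}_j=\mathcal{N}_{\mathcal{G}_j}(\mathcal{E}_j(\mathcal{W}_{j+1}))$ for $j=\ell-2,\dots,1$; and $\mathcal{W}_0=\mathcal{E}_0(\mathcal{W}_1)$. Spectral distance. For symmetric positive definite operators $\mathcal{X},\mathcal{Y}$ on a Hilbert space $U$, $d_\sigma(\mathcal{X},\mathcal{Y})=\sup_{u\in U\setminus\{0\}}|\ln(\mathcal{X}u,u)-\ln(\mathcal{Y}u,u)|$. The claim includes the implicit assertion that $\mathcal{W}_0$ is symmetric positive definite, so that the distance is defined. *)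

theory Defs
  imports "HOL-Analysis.Analysis"
begin

section \<open>The space \<open>L\<^sup>2\<close>\<close>

text \<open>
  Elements are classes, modulo equality almost everywhere, of square-integrable functions on the
  whole space. For \<open>\<Omega>\<close> a measurable set, \<open>L\<^sup>2(\<Omega>)\<close> is the closed subspace of the classes that vanish
  almost everywhere outside \<open>\<Omega>\<close> (extension by zero); on it the inner product below is the integral
  over \<open>\<Omega>\<close>.
\<close>

definition square_integrable :: "('a::euclidean_space \<Rightarrow> 'b::euclidean_space) \<Rightarrow> bool" where
  "square_integrable f \<longleftrightarrow>
     f \<in> borel_measurable lebesgue \<and> integrable lebesgue (\<lambda>x. (norm (f x))\<^sup>2)"

definition L2_rel :: "('a::euclidean_space \<Rightarrow> 'b::euclidean_space) \<Rightarrow> ('a \<Rightarrow> 'b) \<Rightarrow> bool" where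
  "L2_rel f g \<longleftrightarrow> square_integrable f \<and> square_integrable g \<and> (AE x in lebesgue. f x = g x)"

lemma square_integrable_0: "square_integrable (\<lambda>x. 0)"
  by (simp add: square_integrable_def)

lemma square_integrable_scaleR:
  assumes "square_integrable f"
  shows "square_integrable (\<lambda>x. c *\<^sub>R f x)"
  using assms by (auto simp: square_integrable_def power_mult_distrib)

lemma square_integrable_add:
  assumes f: "square_integrable f" and g: "square_integrable g"
  shows "square_integrable (\<lambda>x. f x + g x)"
proof -
  have m: "(\<lambda>x. f x + g x) \<in> borel_measurable lebesgue"
    using f g by (auto simp: square_integrable_def)
  have i: "integrable lebesgue (\<lambda>x. 2 * (norm (f x))\<^sup>2 + 2 * (norm (g x))\<^sup>2)"
    using f g by (auto simp: square_integrable_def)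
  have "(norm (a + b))\<^sup>2 \<le> 2 * (norm a)\<^sup>2 + 2 * (norm b)\<^sup>2" for a b :: 'b
  proof -
    have "(norm (a + b))\<^sup>2 \<le> (norm a + norm b)\<^sup>2"
      by (intro power_mono norm_triangle_ineq) auto
    also have "\<dots> \<le> 2 * (norm a)\<^sup>2 + 2 * (norm b)\<^sup>2"
      using sum_squares_bound[of "norm a" "norm b"] by (simp add: power2_sum)
    finally show ?thesis .
  qed
  then have "integrable lebesgue (\<lambda>x. (norm (f x + g x))\<^sup>2)"
    using m by (intro Bochner_Integration.integrable_bound[OF i]) auto
  with m show ?thesis by (simp add: square_integrable_def)
qed

lemma square_integrable_inner:
  assumes f: "square_integrable f" and g: "square_integrable g"
  shows "integrable lebesgue (\<lambda>x. f x \<bullet> g x)"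
proof -
  have m: "(\<lambda>x. f x \<bullet> g x) \<in> borel_measurable lebesgue"
    using f g by (auto simp: square_integrable_def)
  have i: "integrable lebesgue (\<lambda>x. (norm (f x))\<^sup>2 + (norm (g x))\<^sup>2)"
    using f g by (auto simp: square_integrable_def)
  have "\<bar>a \<bullet> b\<bar> \<le> (norm a)\<^sup>2 + (norm b)\<^sup>2" for a b :: 'b
  proof -
    have "2 * (norm a * norm b) \<le> (norm a)\<^sup>2 + (norm b)\<^sup>2"
      using sum_squares_bound[of "norm a" "norm b"] by simp
    moreover have "0 \<le> norm a * norm b" by simp
    ultimately show ?thesis using Cauchy_Schwarz_ineq2[of a b] by linarith
  qed
  then show ?thesis
    using m by (intro Bochner_Integration.integrable_bound[OF i]) auto
qed

quotient_type (overloaded) ('a, 'b) L2 =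
  "'a::euclidean_space \<Rightarrow> 'b::euclidean_space" / partial: L2_rel
proof (rule part_equivpI)
  show "\<exists>f. L2_rel f f"
    using square_integrable_0 by (auto simp: L2_rel_def)
  show "symp L2_rel"
    by (auto simp: symp_def L2_rel_def)
  show "transp L2_rel"
    by (auto simp: transp_def L2_rel_def)
qed

instantiation L2 :: (euclidean_space, euclidean_space) real_vector
begin

lift_definition zero_L2 :: "('a, 'b) L2" is "\<lambda>x. 0"
  by (simp add: L2_rel_def square_integrable_0)

lift_definition plus_L2 :: "('a, 'b) L2 \<Rightarrow> ('a, 'b) L2 \<Rightarrow> ('a, 'b) L2" is "\<lambda>f g x. f x + g x"
  by (auto simp: L2_rel_def intro!: square_integrable_add)

lift_definition scaleR_L2 :: "real \<Rightarrow> ('a, 'b) L2 \<Rightarrow> ('a, 'b) L2" is "\<lambda>c f x. c *\<^sub>R f x"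
  by (auto simp: L2_rel_def intro!: square_integrable_scaleR)

definition uminus_L2 :: "('a, 'b) L2 \<Rightarrow> ('a, 'b) L2" where
  "uminus_L2 u = (-1) *\<^sub>R u"

definition minus_L2 :: "('a, 'b) L2 \<Rightarrow> ('a, 'b) L2 \<Rightarrow> ('a, 'b) L2" where
  "minus_L2 u v = u + (-1) *\<^sub>R v"

instance
proof
  fix u v w :: "('a, 'b) L2" and a b :: real
  show "u + v + w = u + (v + w)"
    by transfer (auto simp: L2_rel_def ac_simps intro!: square_integrable_add)
  show "u + v = v + u"
    by transfer (auto simp: L2_rel_def ac_simps intro!: square_integrable_add)
  show "0 + u = u"
    by transfer (auto simp: L2_rel_def)
  show "- u + u = 0"
    unfolding uminus_L2_def
    by transfer (auto simp: L2_rel_def square_integrable_0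
        intro!: square_integrable_add square_integrable_scaleR[where c = "-1", simplified])
  show "u - v = u + - v"
    by (simp add: minus_L2_def uminus_L2_def)
  show "a *\<^sub>R (u + v) = a *\<^sub>R u + a *\<^sub>R v"
    by transfer (auto simp: L2_rel_def scaleR_add_right
        intro!: square_integrable_add square_integrable_scaleR)
  show "(a + b) *\<^sub>R u = a *\<^sub>R u + b *\<^sub>R u"
    by transfer (auto simp: L2_rel_def scaleR_add_left
        intro!: square_integrable_add square_integrable_scaleR)
  show "a *\<^sub>R b *\<^sub>R u = (a * b) *\<^sub>R u"
    by transfer (auto simp: L2_rel_def intro!: square_integrable_scaleR)
  show "1 *\<^sub>R u = u"
    by transfer (auto simp: L2_rel_def)
qed

end

instantiation L2 :: (euclidean_space, euclidean_space) real_inner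
begin

lift_definition inner_L2 :: "('a, 'b) L2 \<Rightarrow> ('a, 'b) L2 \<Rightarrow> real"
  is "\<lambda>f g. LINT x|lebesgue. f x \<bullet> g x"
  by (rule integral_cong_AE) (auto simp: L2_rel_def square_integrable_def)

definition norm_L2 :: "('a, 'b) L2 \<Rightarrow> real" where
  "norm_L2 u = sqrt (u \<bullet> u)"

definition dist_L2 :: "('a, 'b) L2 \<Rightarrow> ('a, 'b) L2 \<Rightarrow> real" where
  "dist_L2 u v = norm (u - v)"

definition sgn_L2 :: "('a, 'b) L2 \<Rightarrow> ('a, 'b) L2" where
  "sgn_L2 u = u /\<^sub>R norm u"

definition uniformity_L2 :: "(('a, 'b) L2 \<times> ('a, 'b) L2) filter" where
  "uniformity_L2 = (INF e\<in>{0 <..}. principal {(u, v). dist u v < e})"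

definition open_L2 :: "('a, 'b) L2 set \<Rightarrow> bool" where
  "open_L2 A \<longleftrightarrow> (\<forall>u\<in>A. eventually (\<lambda>(u', v). u' = u \<longrightarrow> v \<in> A) uniformity)"

instance
proof
  fix u v w :: "('a, 'b) L2" and r :: real and A :: "('a, 'b) L2 set"
  show "dist u v = norm (u - v)" by (fact dist_L2_def)
  show "sgn u = u /\<^sub>R norm u" by (fact sgn_L2_def)
  show "uniformity = (INF e\<in>{0 <..}. principal {(u :: ('a, 'b) L2, v). dist u v < e})"
    by (fact uniformity_L2_def)
  show "open A \<longleftrightarrow> (\<forall>u\<in>A. eventually (\<lambda>(u', v). u' = u \<longrightarrow> v \<in> A) uniformity)"
    by (fact open_L2_def)
  show "norm u = sqrt (u \<bullet> u)" by (fact norm_L2_def)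
  show "u \<bullet> v = v \<bullet> u"
    by transfer (simp add: inner_commute)
  show "(u + v) \<bullet> w = u \<bullet> w + v \<bullet> w"
    by transfer (simp add: inner_add_left L2_rel_def square_integrable_inner)
  show "(r *\<^sub>R u) \<bullet> v = r * (u \<bullet> v)"
    by transfer simp
  show "0 \<le> u \<bullet> u"
    by transfer simp
  show "u \<bullet> u = 0 \<longleftrightarrow> u = 0"
  proof transfer
    fix f :: "'a \<Rightarrow> 'b"
    assume "L2_rel f f"
    then have f: "square_integrable f" by (simp add: L2_rel_def)
    have "(LINT x|lebesgue. f x \<bullet> f x) = 0 \<longleftrightarrow> (AE x in lebesgue. f x \<bullet> f x = 0)"
      by (rule integral_nonneg_eq_0_iff_AE) (auto simp: square_integrable_inner[OF f f])
    then show "(LINT x|lebesgue. f x \<bullet> f x) = 0 \<longleftrightarrow> L2_rel f (\<lambda>x. 0)"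
      using f by (simp add: L2_rel_def square_integrable_0)
  qed
qed

end

definition L2_on :: "'a::euclidean_space set \<Rightarrow> ('a, 'b::euclidean_space) L2 set" where
  "L2_on \<Omega> = {u. AE x in lebesgue. x \<notin> \<Omega> \<longrightarrow> rep_L2 u x = 0}"


section \<open>The space \<open>H\<^sub>0\<^sup>1\<close> and the energy form\<close>

definition grad :: "('a::euclidean_space \<Rightarrow> real) \<Rightarrow> 'a \<Rightarrow> 'a" where
  "grad \<phi> x = (\<Sum>i\<in>Basis. frechet_derivative \<phi> (at x) i *\<^sub>R i)"

primrec C_k :: "nat \<Rightarrow> ('a::euclidean_space \<Rightarrow> real) \<Rightarrow> bool" where
  "C_k 0 \<phi> \<longleftrightarrow> continuous_on UNIV \<phi>"
| "C_k (Suc k) \<phi> \<longleftrightarrow>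
     (\<forall>x. \<phi> differentiable at x) \<and> (\<forall>i\<in>Basis. C_k k (\<lambda>x. frechet_derivative \<phi> (at x) i))"

definition test_functions :: "'a::euclidean_space set \<Rightarrow> ('a \<Rightarrow> real) set" where
  "test_functions \<Omega> =
     {\<phi>. (\<forall>k. C_k k \<phi>) \<and> compact (closure {x. \<phi> x \<noteq> 0}) \<and> closure {x. \<phi> x \<noteq> 0} \<subseteq> \<Omega>}"

definition has_weak_gradient ::
  "'a::euclidean_space set \<Rightarrow> ('a, real) L2 \<Rightarrow> ('a, 'a) L2 \<Rightarrow> bool" where
  "has_weak_gradient \<Omega> u g \<longleftrightarrow> u \<in> L2_on \<Omega> \<and> g \<in> L2_on \<Omega> \<and>
     (\<forall>\<phi>\<in>test_functions \<Omega>.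
        (LINT x:\<Omega>|lebesgue. rep_L2 u x *\<^sub>R grad \<phi> x) = - (LINT x:\<Omega>|lebesgue. \<phi> x *\<^sub>R rep_L2 g x))"

text \<open>
  For open \<open>\<Omega>\<close> a weak gradient is unique as a class in \<open>L\<^sup>2(\<Omega>)\<close>.
\<close>

definition weak_gradient :: "'a::euclidean_space set \<Rightarrow> ('a, real) L2 \<Rightarrow> ('a, 'a) L2" where
  "weak_gradient \<Omega> u = (THE g. has_weak_gradient \<Omega> u g)"

definition H1 :: "'a::euclidean_space set \<Rightarrow> ('a, real) L2 set" where
  "H1 \<Omega> = {u. \<exists>g. has_weak_gradient \<Omega> u g}"

text \<open>
  The norm of the product type is the square root of the sum of the squared norms, so
  \<open>u \<mapsto> (u, \<nabla>u)\<close> is an isometry for the norm of \<open>H\<^sup>1(\<Omega>)\<close>, and the closure below is the closure of the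
  test functions in \<open>H\<^sup>1(\<Omega>)\<close>. Test functions and their gradients are square-integrable, so
  \<open>abs_L2\<close> yields their classes.
\<close>

definition H1_0 :: "'a::euclidean_space set \<Rightarrow> ('a, real) L2 set" where
  "H1_0 \<Omega> = {u \<in> H1 \<Omega>.
     (u, weak_gradient \<Omega> u) \<in> closure ((\<lambda>\<phi>. (abs_L2 \<phi>, abs_L2 (grad \<phi>))) ` test_functions \<Omega>)}"

definition energy_form ::
  "'a::euclidean_space set \<Rightarrow> ('a \<Rightarrow> real) \<Rightarrow> ('a, real) L2 \<Rightarrow> ('a, real) L2 \<Rightarrow> real" where
  "energy_form \<Omega> \<kappa> y v =
     (LINT x:\<Omega>|lebesgue. \<kappa> x * (rep_L2 (weak_gradient \<Omega> y) x \<bullet> rep_L2 (weak_gradient \<Omega> v) x))"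


section \<open>Operators on subspaces\<close>

text \<open>
  A linear map between subspaces is a function on the ambient type whose values outside the
  domain are irrelevant. All inclusions between nested subspaces are therefore the identity and
  are not written.
\<close>

definition linear_between ::
  "'h::real_vector set \<Rightarrow> 'k::real_vector set \<Rightarrow> ('h \<Rightarrow> 'k) \<Rightarrow> bool" where
  "linear_between U V T \<longleftrightarrow> T ` U \<subseteq> V \<and>
     (\<forall>u\<in>U. \<forall>v\<in>U. T (u + v) = T u + T v) \<and> (\<forall>c. \<forall>u\<in>U. T (c *\<^sub>R u) = c *\<^sub>R T u)"

definition finite_dim_subspace :: "'h::real_vector set \<Rightarrow> bool" where
  "finite_dim_subspace U \<longleftrightarrow> (\<exists>B. finite B \<and> span B = U)"

definition op_norm ::
  "'h::real_normed_vector set \<Rightarrow> ('h \<Rightarrow> 'k::real_normed_vector) \<Rightarrow> real" where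
  "op_norm U T = (SUP u\<in>U - {0}. norm (T u) / norm u)"

text \<open>The adjoint of \<open>T\<close> as an operator with domain \<open>U\<close>.\<close>

definition adjoint_on ::
  "'h::real_inner set \<Rightarrow> ('h \<Rightarrow> 'k::real_inner) \<Rightarrow> 'k \<Rightarrow> 'h" where
  "adjoint_on U T y = (THE u. u \<in> U \<and> (\<forall>w\<in>U. T w \<bullet> y = w \<bullet> u))"

definition spd_on :: "'h::real_inner set \<Rightarrow> ('h \<Rightarrow> 'h) \<Rightarrow> bool" where
  "spd_on U X \<longleftrightarrow> linear_between U U X \<and>
     (\<forall>u\<in>U. \<forall>v\<in>U. X u \<bullet> v = u \<bullet> X v) \<and> (\<forall>u\<in>U - {0}. 0 < X u \<bullet> u)"

definition spectral_distance ::
  "'h::real_inner set \<Rightarrow> ('h \<Rightarrow> 'h) \<Rightarrow> ('h \<Rightarrow> 'h) \<Rightarrow> real" where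
  "spectral_distance U X Y = (SUP u\<in>U - {0}. \<bar>ln (X u \<bullet> u) - ln (Y u \<bullet> u)\<bar>)"

definition is_solution_operator ::
  "'a::euclidean_space set \<Rightarrow> ('a \<Rightarrow> real) \<Rightarrow> ('a, real) L2 set \<Rightarrow> ('a, real) L2 set \<Rightarrow>
     (('a, real) L2 \<Rightarrow> ('a, real) L2) \<Rightarrow> bool" where
  "is_solution_operator \<Omega> \<kappa> U Y K \<longleftrightarrow> linear_between U Y K \<and>
     (\<forall>u\<in>U. \<forall>v\<in>Y. energy_form \<Omega> \<kappa> (K u) v = u \<bullet> v)"


section \<open>The multilevel preconditioner\<close>

text \<open>The \<open>L\<^sup>2\<close>-projection \<open>\<Pi>\<^sub>j\<close>: the adjoint of the inclusion of \<open>U\<^sub>j\<^sub>+\<^sub>1\<close> in \<open>U\<^sub>j\<close>.\<close>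

definition Pi_op :: "(nat \<Rightarrow> 'h::real_inner set) \<Rightarrow> nat \<Rightarrow> 'h \<Rightarrow> 'h" where
  "Pi_op U j = adjoint_on (U (Suc j)) (\<lambda>w. w)"

definition G_op ::
  "real \<Rightarrow> (nat \<Rightarrow> 'h::real_inner set) \<Rightarrow> (nat \<Rightarrow> 'h \<Rightarrow> 'k::real_inner) \<Rightarrow> nat \<Rightarrow> 'h \<Rightarrow> 'h" where
  "G_op \<beta> U K j u = adjoint_on (U j) (K j) (K j u) + \<beta> *\<^sub>R u"

definition G_inv ::
  "real \<Rightarrow> (nat \<Rightarrow> 'h::real_inner set) \<Rightarrow> (nat \<Rightarrow> 'h \<Rightarrow> 'k::real_inner) \<Rightarrow> nat \<Rightarrow> 'h \<Rightarrow> 'h" where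
  "G_inv \<beta> U K j = inv_into (U j) (G_op \<beta> U K j)"

definition N_op :: "('h \<Rightarrow> 'h) \<Rightarrow> ('h \<Rightarrow> 'h) \<Rightarrow> 'h::real_vector \<Rightarrow> 'h" where
  "N_op X Y u = 2 *\<^sub>R Y u - Y (X (Y u))"

definition E_op ::
  "real \<Rightarrow> (nat \<Rightarrow> 'h::real_inner set) \<Rightarrow> nat \<Rightarrow> ('h \<Rightarrow> 'h) \<Rightarrow> 'h \<Rightarrow> 'h" where
  "E_op \<beta> U j X u = X (Pi_op U j u) + inverse \<beta> *\<^sub>R (u - Pi_op U j u)"

function W_op ::
  "nat \<Rightarrow> real \<Rightarrow> (nat \<Rightarrow> 'h::real_inner set) \<Rightarrow> (nat \<Rightarrow> 'h \<Rightarrow> 'k::real_inner) \<Rightarrow>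
     nat \<Rightarrow> 'h \<Rightarrow> 'h" where
  "W_op l \<beta> U K j =
     (if j \<ge> l - 1 then G_inv \<beta> U K (l - 1)
      else if j = 0 then E_op \<beta> U 0 (W_op l \<beta> U K 1)
      else N_op (G_op \<beta> U K j) (E_op \<beta> U j (W_op l \<beta> U K (Suc j))))"
  by pat_completeness auto
termination
  by (relation "Wellfounded.measure (\<lambda>(l, \<beta>, U, K, j). l - 1 - j)") auto

declare W_op.simps [simp del]

end

theory Submission
  imports Defs
begin

text \<open>
  All spectral comparisons are order relations \<open>X \<le> e\<^sup>d Y \<le> e\<^sup>2\<^sup>d X\<close> between quadratic forms. The
  inverse of \<open>E\<^sub>j(G\<^sub>j\<^sub>+\<^sub>1\<^sup>-\<^sup>1)\<close> has the energy \<open>\<parallel>K\<^sub>j\<^sub>+\<^sub>1\<Pi>\<^sub>ju\<parallel>\<^sup>2 + \<beta>\<parallel>u\<parallel>\<^sup>2\<close>, which differs from that of \<open>G\<^sub>j\<close> by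
  at most \<open>2 C a\<^sub>j \<parallel>u\<parallel>\<^sup>2\<close>, so the two-level operator is within \<open>b\<^sub>j\<close> of \<open>G\<^sub>j\<^sup>-\<^sup>1\<close>; moreover \<open>E\<^sub>j\<close> does not
  increase distances. Since \<open>G\<^sup>-\<^sup>1 - N\<^sub>G(Y) = (Y - G\<^sup>-\<^sup>1) G (Y - G\<^sup>-\<^sup>1)\<close>, a Newton step turns a distance
  \<open>d \<le> 0.35\<close> into at most \<open>2 d\<^sup>2\<close>. As \<open>2 (1/4 + 1/10)\<^sup>2 < 1/4\<close>, downward induction gives
  \<open>d(W\<^sub>j, G\<^sub>j\<^sup>-\<^sup>1) \<le> f\<^sup>l\<^sup>-\<^sup>j / 4\<close> for \<open>j \<ge> 1\<close>, and the last level, without Newton step, adds \<open>b\<^sub>0\<close>.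
\<close>

section \<open>Operators on finite-dimensional subspaces\<close>

lemma finite_dim_subspace_imp_subspace: "finite_dim_subspace U \<Longrightarrow> subspace U"
  unfolding finite_dim_subspace_def using subspace_span by blast

lemma finite_dim_subspace_orthogonal_basis:
  fixes U :: "'h::real_inner set"
  assumes "finite_dim_subspace U"
  obtains C where "finite C" "span C = U" "pairwise orthogonal C"
  using assms basis_orthogonal unfolding finite_dim_subspace_def by metis

section \<open>Linear maps between subspaces\<close>

lemma linear_between_mem: "linear_between U V T \<Longrightarrow> u \<in> U \<Longrightarrow> T u \<in> V"
  by (auto simp: linear_between_def)

lemma linear_between_add:
  "linear_between U V T \<Longrightarrow> u \<in> U \<Longrightarrow> v \<in> U \<Longrightarrow> T (u + v) = T u + T v"
  by (auto simp: linear_between_def)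

lemma linear_between_scaleR:
  "linear_between U V T \<Longrightarrow> u \<in> U \<Longrightarrow> T (c *\<^sub>R u) = c *\<^sub>R T u"
  by (auto simp: linear_between_def)

lemma linear_between_diff:
  assumes "linear_between U V T" "subspace U" "u \<in> U" "v \<in> U"
  shows "T (u - v) = T u - T v"
  using linear_between_add[OF assms(1,3), of "(-1) *\<^sub>R v"]
    linear_between_scaleR[OF assms(1,4), of "-1"] assms(2,4)
  by (simp add: subspace_neg)

lemma linear_between_subset:
  "linear_between U V T \<Longrightarrow> U' \<subseteq> U \<Longrightarrow> V \<subseteq> V' \<Longrightarrow> linear_between U' V' T"
  by (simp add: linear_between_def image_subset_iff) blast

lemma linear_between_compose:
  "linear_between U V T \<Longrightarrow> linear_between V W S \<Longrightarrow> linear_between U W (\<lambda>u. S (T u))"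
  by (simp add: linear_between_def image_subset_iff)

lemma linear_between_sum:
  assumes T: "linear_between U V T" and U: "subspace U" and C: "finite C" "C \<subseteq> U"
  shows "T (\<Sum>c\<in>C. r c *\<^sub>R c) = (\<Sum>c\<in>C. r c *\<^sub>R T c)"
  using C
proof (induction rule: finite_induct)
  case empty
  then show ?case
    using linear_between_scaleR[OF T subspace_0[OF U], of 0] by simp
next
  case (insert x F)
  have "(\<Sum>c\<in>F. r c *\<^sub>R c) \<in> U"
    using insert.prems by (intro subspace_sum subspace_scale U) auto
  then have "T (r x *\<^sub>R x + (\<Sum>c\<in>F. r c *\<^sub>R c)) = r x *\<^sub>R T x + T (\<Sum>c\<in>F. r c *\<^sub>R c)"
    using insert.prems U T by (simp add: linear_between_add linear_between_scaleR subspace_scale)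
  with insert show ?case by simp
qed

section \<open>Orthogonal expansions, Riesz representation and adjoints\<close>

lemma orthogonal_expansion:
  fixes C :: "'h::real_inner set"
  assumes "finite C" "pairwise orthogonal C" "u \<in> span C"
  shows "u = (\<Sum>c\<in>C. (u \<bullet> c / (c \<bullet> c)) *\<^sub>R c)"
proof -
  obtain r where r: "u = (\<Sum>c\<in>C. r c *\<^sub>R c)"
    using assms span_finite[of C] by auto
  have "u \<bullet> d = r d * (d \<bullet> d)" if d: "d \<in> C" for d
  proof -
    have "u \<bullet> d = (\<Sum>c\<in>C. r c * (c \<bullet> d))"
      by (simp add: r inner_sum_left)
    also have "\<dots> = (\<Sum>c\<in>C. if c = d then r d * (d \<bullet> d) else 0)"
      using assms(2) d by (intro sum.cong refl) (auto simp: pairwise_def orthogonal_def)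
    finally show ?thesis using assms(1) d by simp
  qed
  \<comment> \<open>The spanning set may contain the zero vector: division by zero then yields the
    coefficient 0, and the term vanishes on both sides.\<close>
  then have "(\<Sum>c\<in>C. (u \<bullet> c / (c \<bullet> c)) *\<^sub>R c) = (\<Sum>c\<in>C. r c *\<^sub>R c)"
    by (intro sum.cong refl) auto
  with r show ?thesis by simp
qed

text \<open>The values of \<open>\<phi>\<close> on an orthogonal spanning set give the coefficients
  of the representing vector, so completeness of the ambient space does not enter.\<close>

lemma Riesz_finite_dim:
  fixes \<phi> :: "'h::real_inner \<Rightarrow> real"
  assumes U: "finite_dim_subspace U" and \<phi>: "linear_between U UNIV \<phi>"
  obtains x where "x \<in> U" "\<And>w. w \<in> U \<Longrightarrow> \<phi> w = w \<bullet> x"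
proof -
  obtain C where C: "finite C" "span C = U" "pairwise orthogonal C"
    using finite_dim_subspace_orthogonal_basis[OF U] .
  have CU: "C \<subseteq> U" using C span_superset by blast
  define x where "x = (\<Sum>c\<in>C. (\<phi> c / (c \<bullet> c)) *\<^sub>R c)"
  have "x \<in> U"
    unfolding x_def using CU U
    by (intro subspace_sum subspace_scale finite_dim_subspace_imp_subspace) auto
  moreover have "\<phi> w = w \<bullet> x" if "w \<in> U" for w
  proof -
    have "\<phi> w = \<phi> (\<Sum>c\<in>C. (w \<bullet> c / (c \<bullet> c)) *\<^sub>R c)"
      using orthogonal_expansion[OF C(1,3)] that C(2) by simp
    also have "\<dots> = (\<Sum>c\<in>C. (w \<bullet> c / (c \<bullet> c)) *\<^sub>R \<phi> c)"
      by (rule linear_between_sum[OF \<phi> finite_dim_subspace_imp_subspace[OF U] C(1) CU])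
    also have "\<dots> = w \<bullet> x"
      by (simp add: x_def inner_sum_right algebra_simps)
    finally show ?thesis .
  qed
  ultimately show ?thesis using that by blast
qed

lemma eq_if_inner_eq_on:
  fixes x y :: "'h::real_inner"
  assumes "subspace U" "x \<in> U" "y \<in> U" "\<And>w. w \<in> U \<Longrightarrow> w \<bullet> x = w \<bullet> y"
  shows "x = y"
proof -
  have "(x - y) \<bullet> (x - y) = 0"
    using assms(4)[of "x - y"] assms(1-3) by (simp add: subspace_diff inner_diff_right)
  then show ?thesis by simp
qed

text \<open>Riesz representation gives existence and testing against all of \<open>U\<close> gives
  uniqueness, so the \<open>THE\<close> in the definition denotes the intended vector.\<close>

lemma adjoint_on:
  fixes T :: "'h::real_inner \<Rightarrow> 'k::real_inner"
  assumes U: "finite_dim_subspace U" and T: "linear_between U V T"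
  shows "adjoint_on U T y \<in> U" "w \<in> U \<Longrightarrow> w \<bullet> adjoint_on U T y = T w \<bullet> y"
proof -
  have "linear_between U UNIV (\<lambda>w. T w \<bullet> y)"
    using T by (auto simp: linear_between_def inner_add_left)
  then obtain x where x: "x \<in> U" "\<And>w. w \<in> U \<Longrightarrow> T w \<bullet> y = w \<bullet> x"
    using Riesz_finite_dim[OF U] by blast
  have "\<exists>!x. x \<in> U \<and> (\<forall>w\<in>U. T w \<bullet> y = w \<bullet> x)"
    using x eq_if_inner_eq_on[OF finite_dim_subspace_imp_subspace[OF U]] by (metis (no_types))
  from theI'[OF this]
  show "adjoint_on U T y \<in> U" "w \<in> U \<Longrightarrow> w \<bullet> adjoint_on U T y = T w \<bullet> y"
    by (auto simp: adjoint_on_def)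
qed

lemma linear_adjoint_on:
  fixes T :: "'h::real_inner \<Rightarrow> 'k::real_inner"
  assumes U: "finite_dim_subspace U" and T: "linear_between U V T"
  shows "linear_between UNIV U (adjoint_on U T)"
proof -
  note sU = finite_dim_subspace_imp_subspace[OF U]
  note adj = adjoint_on[OF U T]
  have "adjoint_on U T (x + y) = adjoint_on U T x + adjoint_on U T y" for x y
    by (rule eq_if_inner_eq_on[OF sU]) (auto simp: adj inner_add_right intro!: subspace_add[OF sU])
  moreover have "adjoint_on U T (c *\<^sub>R x) = c *\<^sub>R adjoint_on U T x" for c x
    by (rule eq_if_inner_eq_on[OF sU]) (auto simp: adj intro!: subspace_scale[OF sU])
  ultimately show ?thesis
    using adj by (auto simp: linear_between_def)
qed

section \<open>Boundedness and the operator norm\<close>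

lemma bounded_on_finite_dim:
  fixes T :: "'h::real_inner \<Rightarrow> 'k::real_normed_vector"
  assumes U: "finite_dim_subspace U" and T: "linear_between U V T"
  obtains M where "\<And>u. u \<in> U \<Longrightarrow> norm (T u) \<le> M * norm u"
proof -
  obtain C where C: "finite C" "span C = U" "pairwise orthogonal C"
    using finite_dim_subspace_orthogonal_basis[OF U] .
  have CU: "C \<subseteq> U" using C span_superset by blast
  have "norm (T u) \<le> (\<Sum>c\<in>C. norm c / (c \<bullet> c) * norm (T c)) * norm u" if "u \<in> U" for u
  proof -
    have "T u = T (\<Sum>c\<in>C. (u \<bullet> c / (c \<bullet> c)) *\<^sub>R c)"
      using orthogonal_expansion[OF C(1,3)] that C(2) by simp
    also have "\<dots> = (\<Sum>c\<in>C. (u \<bullet> c / (c \<bullet> c)) *\<^sub>R T c)"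
      by (rule linear_between_sum[OF T finite_dim_subspace_imp_subspace[OF U] C(1) CU])
    also have "norm \<dots> \<le> (\<Sum>c\<in>C. norm ((u \<bullet> c / (c \<bullet> c)) *\<^sub>R T c))"
      by (rule norm_sum)
    also have "\<dots> \<le> (\<Sum>c\<in>C. (norm u * norm c / (c \<bullet> c)) * norm (T c))"
      by (intro sum_mono) (auto intro!: mult_right_mono divide_right_mono Cauchy_Schwarz_ineq2)
    also have "\<dots> = (\<Sum>c\<in>C. norm c / (c \<bullet> c) * norm (T c)) * norm u"
      by (simp add: sum_distrib_left algebra_simps)
    finally show ?thesis .
  qed
  then show ?thesis using that by blast
qed

text \<open>A real supremum bounds its set only if the set is bounded above; this turns bounds on
  \<open>op_norm\<close> into pointwise estimates.\<close>

lemma bdd_above_op_norm: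
  fixes T :: "'h::real_inner \<Rightarrow> 'k::real_normed_vector"
  assumes U: "finite_dim_subspace U" and T: "linear_between U V T"
  shows "bdd_above ((\<lambda>u. norm (T u) / norm u) ` (U - {0}))"
proof -
  obtain M where "\<And>u. u \<in> U \<Longrightarrow> norm (T u) \<le> M * norm u"
    using bounded_on_finite_dim[OF U T] by blast
  then show ?thesis
    by (intro bdd_aboveI2[where M = M]) (auto simp: divide_simps)
qed

lemma norm_le_op_norm:
  fixes T :: "'h::real_inner \<Rightarrow> 'k::real_normed_vector"
  assumes U: "finite_dim_subspace U" and T: "linear_between U V T" and u: "u \<in> U"
  shows "norm (T u) \<le> op_norm U T * norm u"
proof (cases "u = 0")
  case True
  then show ?thesis
    using linear_between_scaleR[OF T u, of 0] by simp
next
  case False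
  then have "norm (T u) / norm u \<le> op_norm U T"
    unfolding op_norm_def using u by (intro cSUP_upper bdd_above_op_norm[OF U T]) auto
  with False show ?thesis by (simp add: divide_simps)
qed

text \<open>A nonzero vector is required, since the supremum over an empty set has no prescribed
  value.\<close>

lemma op_norm_nonneg:
  fixes T :: "'h::real_inner \<Rightarrow> 'k::real_normed_vector"
  assumes U: "finite_dim_subspace U" "U \<noteq> {0}" and T: "linear_between U V T"
  shows "0 \<le> op_norm U T"
proof -
  obtain u where u: "u \<in> U" "u \<noteq> 0"
    using U subspace_0[OF finite_dim_subspace_imp_subspace[OF U(1)]] by blast
  have "0 \<le> op_norm U T * norm u"
    using norm_le_op_norm[OF U(1) T u(1)] norm_ge_zero order_trans by blast
  with u show ?thesis by (simp add: zero_le_mult_iff)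
qed

text \<open>Serves to apply Riesz representation on the graph of a solution operator.\<close>

lemma finite_dim_subspace_image:
  assumes U: "finite_dim_subspace U" and T: "linear_between U V T"
  shows "finite_dim_subspace (T ` U)"
proof -
  obtain B where B: "finite B" "span B = U"
    using U by (auto simp: finite_dim_subspace_def)
  note sU = finite_dim_subspace_imp_subspace[OF U]
  have BU: "B \<subseteq> U" using B span_superset by blast
  have "subspace (T ` U)"
  proof (rule subspaceI)
    show "0 \<in> T ` U"
      using linear_between_scaleR[OF T subspace_0[OF sU], of 0] subspace_0[OF sU] by force
    show "x + y \<in> T ` U" if "x \<in> T ` U" "y \<in> T ` U" for x y
      using that by (auto simp: linear_between_add[OF T, symmetric] intro!: imageI subspace_add[OF sU])
    show "c *\<^sub>R x \<in> T ` U" if "x \<in> T ` U" for c x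
      using that by (auto simp: linear_between_scaleR[OF T, symmetric] intro!: imageI subspace_scale[OF sU])
  qed
  then have "span (T ` B) \<subseteq> T ` U"
    using BU by (intro span_minimal image_mono) auto
  moreover have "T ` U \<subseteq> span (T ` B)"
  proof (rule image_subsetI)
    fix u assume "u \<in> U"
    then obtain r where "u = (\<Sum>c\<in>B. r c *\<^sub>R c)"
      using B span_finite[of B] by auto
    then have "T u = (\<Sum>c\<in>B. r c *\<^sub>R T c)"
      using linear_between_sum[OF T sU B(1) BU] by simp
    moreover have "r c *\<^sub>R T c \<in> span (T ` B)" if "c \<in> B" for c
      using that by (intro span_scale span_base imageI)
    ultimately show "T u \<in> span (T ` B)"
      by (simp add: span_sum)
  qed
  ultimately show ?thesis
    using B(1) unfolding finite_dim_subspace_def by blast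
qed

section \<open>The regularized normal operator\<close>

lemma inner_G_op:
  fixes K :: "nat \<Rightarrow> 'h::real_inner \<Rightarrow> 'k::real_inner"
  assumes U: "finite_dim_subspace (U j)" and K: "linear_between (U j) V (K j)" and q: "q \<in> U j"
  shows "G_op \<beta> U K j p \<bullet> q = K j p \<bullet> K j q + \<beta> * (p \<bullet> q)"
  using adjoint_on(2)[OF U K q, of "K j p"]
  by (simp add: G_op_def inner_simps inner_commute[of _ q] inner_commute[of _ "K j q"])

lemma spd_on_G_op:
  fixes K :: "nat \<Rightarrow> 'h::real_inner \<Rightarrow> 'k::real_inner"
  assumes U: "finite_dim_subspace (U j)" and K: "linear_between (U j) V (K j)" and \<beta>: "0 < \<beta>"
  shows "spd_on (U j) (G_op \<beta> U K j)"
proof -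
  note sU = finite_dim_subspace_imp_subspace[OF U]
  note adj = linear_adjoint_on[OF U K]
  have "linear_between (U j) (U j) (G_op \<beta> U K j)"
    unfolding linear_between_def G_op_def
    using linear_between_mem[OF adj] linear_between_add[OF adj] linear_between_scaleR[OF adj]
      linear_between_add[OF K] linear_between_scaleR[OF K]
    by (auto simp: algebra_simps intro!: subspace_add[OF sU] subspace_scale[OF sU])
  moreover have "G_op \<beta> U K j u \<bullet> v = u \<bullet> G_op \<beta> U K j v" if "u \<in> U j" "v \<in> U j" for u v
    using inner_G_op[where U=U and K=K, OF U K that(1), of \<beta> v] inner_G_op[where U=U and K=K, OF U K that(2), of \<beta> u]
    by (simp add: inner_commute)
  moreover have "0 < G_op \<beta> U K j u \<bullet> u" if "u \<in> U j - {0}" for u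
    using that \<beta> inner_G_op[where U=U and K=K, OF U K, of u \<beta> u] by (simp add: add_nonneg_pos)
  ultimately show ?thesis by (simp add: spd_on_def)
qed

lemma spd_on_inj:
  fixes X :: "'h::real_inner \<Rightarrow> 'h"
  assumes U: "subspace U" and X: "spd_on U X"
  shows "inj_on X U"
proof (rule inj_onI, rule ccontr)
  fix u v assume uv: "u \<in> U" "v \<in> U" "X u = X v" "u \<noteq> v"
  then have "X (u - v) = 0"
    using X linear_between_diff[OF _ U uv(1,2), of U X] by (simp add: spd_on_def)
  moreover have "0 < X (u - v) \<bullet> (u - v)"
    using X uv subspace_diff[OF U] by (auto simp: spd_on_def)
  ultimately show False by simp
qed

text \<open>
  The energy form of \<open>G\<^sub>j\<close> is the inner product of the graph space \<open>{(K p, \<surd>\<beta> p)}\<close>, so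
  surjectivity is the Riesz representation there.
\<close>

lemma G_op_surj:
  fixes K :: "nat \<Rightarrow> 'h::real_inner \<Rightarrow> 'k::real_inner"
  assumes U: "finite_dim_subspace (U j)" and K: "linear_between (U j) V (K j)" and \<beta>: "0 < \<beta>"
    and u: "u \<in> U j"
  obtains v where "v \<in> U j" "G_op \<beta> U K j v = u"
proof -
  note sU = finite_dim_subspace_imp_subspace[OF U]
  define J where "J p = (K j p, sqrt \<beta> *\<^sub>R p)" for p
  have J: "linear_between (U j) UNIV J"
    using K by (auto simp: linear_between_def J_def algebra_simps)
  \<comment> \<open>At \<open>J q\<close> this functional equals \<open>q \<bullet> u\<close>: the
    second component recovers \<open>q\<close>, and the factor undoes its scaling.\<close>
  have "linear_between (J ` U j) UNIV (\<lambda>z. inverse (sqrt \<beta>) * (snd z \<bullet> u))"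
    by (auto simp: linear_between_def algebra_simps)
  then obtain z where z: "z \<in> J ` U j"
    "\<And>w. w \<in> J ` U j \<Longrightarrow> inverse (sqrt \<beta>) * (snd w \<bullet> u) = w \<bullet> z"
    using Riesz_finite_dim[OF finite_dim_subspace_image[OF U J]] by blast
  then obtain v where v: "v \<in> U j" "z = J v" by blast
  have "q \<bullet> G_op \<beta> U K j v = q \<bullet> u" if q: "q \<in> U j" for q
  proof -
    have "inverse (sqrt \<beta>) * (snd (J q) \<bullet> u) = J q \<bullet> J v"
      using z(2)[of "J q"] v q by simp
    then have "q \<bullet> u = K j q \<bullet> K j v + \<beta> * (q \<bullet> v)"
      using \<beta> by (simp add: J_def inner_prod_def flip: mult.assoc)
    then show ?thesis
      using inner_G_op[where U=U and K=K, OF U K q, of \<beta> v] by (simp add: inner_commute)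
  qed
  moreover have "G_op \<beta> U K j v \<in> U j"
    using spd_on_G_op[where U=U and K=K, OF U K \<beta>] v by (auto simp: spd_on_def intro: linear_between_mem)
  ultimately have "G_op \<beta> U K j v = u"
    by (intro eq_if_inner_eq_on[OF sU] u) auto
  with v that show ?thesis by blast
qed

lemma G_inv:
  fixes K :: "nat \<Rightarrow> 'h::real_inner \<Rightarrow> 'k::real_inner"
  assumes U: "finite_dim_subspace (U j)" and K: "linear_between (U j) V (K j)" and \<beta>: "0 < \<beta>"
    and u: "u \<in> U j"
  shows "G_inv \<beta> U K j u \<in> U j" "G_op \<beta> U K j (G_inv \<beta> U K j u) = u"
proof -
  have "u \<in> G_op \<beta> U K j ` U j"
    using G_op_surj[where U=U and K=K, OF assms] by blast
  then show "G_inv \<beta> U K j u \<in> U j" "G_op \<beta> U K j (G_inv \<beta> U K j u) = u"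
    by (auto simp: G_inv_def inv_into_into f_inv_into_f)
qed

text \<open>As \<open>X\<close> is injective, the linearity laws of \<open>H\<close> can be checked
  after applying \<open>X\<close>. Symmetry and positivity follow on writing \<open>u\<close> as
  \<open>X (H u)\<close>.\<close>

lemma spd_on_right_inverse:
  fixes X H :: "'h::real_inner \<Rightarrow> 'h"
  assumes U: "subspace U" and X: "spd_on U X"
    and H: "\<And>u. u \<in> U \<Longrightarrow> H u \<in> U" "\<And>u. u \<in> U \<Longrightarrow> X (H u) = u"
  shows "spd_on U H"
proof -
  have lX: "linear_between U U X" and sym: "\<And>u v. u \<in> U \<Longrightarrow> v \<in> U \<Longrightarrow> X u \<bullet> v = u \<bullet> X v"
    and pos: "\<And>u. u \<in> U \<Longrightarrow> u \<noteq> 0 \<Longrightarrow> 0 < X u \<bullet> u"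
    using X by (auto simp: spd_on_def)
  note inj = inj_onD[OF spd_on_inj[OF U X]]
  have "H (u + v) = H u + H v" if "u \<in> U" "v \<in> U" for u v
    by (rule inj) (use that H U lX in \<open>simp_all add: linear_between_add subspace_add\<close>)
  moreover have "H (c *\<^sub>R u) = c *\<^sub>R H u" if "u \<in> U" for c u
    by (rule inj) (use that H U lX in \<open>simp_all add: linear_between_scaleR subspace_scale\<close>)
  moreover have "H u \<bullet> v = u \<bullet> H v" if "u \<in> U" "v \<in> U" for u v
    using sym[of "H u" "H v"] H that by (metis inner_commute)
  moreover have "0 < H u \<bullet> u" if "u \<in> U" "u \<noteq> 0" for u
  proof -
    have "H u \<noteq> 0"
      using H(2)[OF that(1)] linear_between_scaleR[OF lX subspace_0[OF U], of 0] that(2) by force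
    then show ?thesis
      using pos[of "H u"] H that by (simp add: inner_commute)
  qed
  ultimately show ?thesis
    using H(1) by (auto simp: spd_on_def linear_between_def)
qed

lemma spd_on_G_inv:
  fixes K :: "nat \<Rightarrow> 'h::real_inner \<Rightarrow> 'k::real_inner"
  assumes U: "finite_dim_subspace (U j)" and K: "linear_between (U j) V (K j)" and \<beta>: "0 < \<beta>"
  shows "spd_on (U j) (G_inv \<beta> U K j)"
  by (rule spd_on_right_inverse[OF finite_dim_subspace_imp_subspace[OF U] spd_on_G_op[where U=U and K=K, OF U K \<beta>]])
    (auto simp: G_inv[where U=U and K=K, OF U K \<beta>])

section \<open>Spectral closeness\<close>

text \<open>For positive definite operators this is the bound \<open>d\<close> on the spectral
  distance with the logarithms removed. It needs no supremum, makes sense at \<open>u = 0\<close>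
  too, and radii add under composition.\<close>

definition spectrally_close ::
  "'h::real_inner set \<Rightarrow> real \<Rightarrow> ('h \<Rightarrow> 'h) \<Rightarrow> ('h \<Rightarrow> 'h) \<Rightarrow> bool" where
  "spectrally_close U d X Y \<longleftrightarrow>
     (\<forall>u\<in>U. X u \<bullet> u \<le> exp d * (Y u \<bullet> u) \<and> Y u \<bullet> u \<le> exp d * (X u \<bullet> u))"

lemma spd_on_nonneg: "spd_on U X \<Longrightarrow> u \<in> U \<Longrightarrow> 0 \<le> X u \<bullet> u"
  by (cases "u = 0") (auto simp: spd_on_def less_imp_le)

lemma spectrally_close_refl:
  assumes "spd_on U X" "0 \<le> d"
  shows "spectrally_close U d X X"
  using mult_right_mono[OF _ spd_on_nonneg[OF assms(1)], of 1 "exp d"] assms(2)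
  by (simp add: spectrally_close_def)

lemma spectrally_close_trans:
  assumes XY: "spectrally_close U d X Y" and YZ: "spectrally_close U e Y Z"
  shows "spectrally_close U (d + e) X Z"
  unfolding spectrally_close_def
proof (intro ballI conjI)
  fix u assume u: "u \<in> U"
  have "X u \<bullet> u \<le> exp d * (Y u \<bullet> u)" "Y u \<bullet> u \<le> exp e * (Z u \<bullet> u)"
    "Y u \<bullet> u \<le> exp d * (X u \<bullet> u)" "Z u \<bullet> u \<le> exp e * (Y u \<bullet> u)"
    using XY YZ u by (auto simp: spectrally_close_def)
  note h = this
  from h(1) have "X u \<bullet> u \<le> exp d * (exp e * (Z u \<bullet> u))"
    by (rule order_trans) (use h in \<open>simp\<close>)
  then show "X u \<bullet> u \<le> exp (d + e) * (Z u \<bullet> u)" by (simp add: exp_add mult_ac)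
  from h(4) have "Z u \<bullet> u \<le> exp e * (exp d * (X u \<bullet> u))"
    by (rule order_trans) (use h in \<open>simp\<close>)
  then show "Z u \<bullet> u \<le> exp (d + e) * (X u \<bullet> u)" by (simp add: exp_add mult_ac)
qed

lemma spectrally_close_mono:
  assumes "spectrally_close U d X Y" "d \<le> e" "spd_on U X" "spd_on U Y"
  shows "spectrally_close U e X Y"
  unfolding spectrally_close_def
proof (intro ballI conjI)
  fix u assume u: "u \<in> U"
  have *: "X u \<bullet> u \<le> exp d * (Y u \<bullet> u)" "Y u \<bullet> u \<le> exp d * (X u \<bullet> u)"
    using assms(1) u by (auto simp: spectrally_close_def)
  show "X u \<bullet> u \<le> exp e * (Y u \<bullet> u)"
    using *(1) by (rule order_trans) (use assms u in \<open>auto intro!: mult_right_mono spd_on_nonneg\<close>)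
  show "Y u \<bullet> u \<le> exp e * (X u \<bullet> u)"
    using *(2) by (rule order_trans) (use assms u in \<open>auto intro!: mult_right_mono spd_on_nonneg\<close>)
qed

lemma spectral_distance_le:
  assumes U: "subspace U" "U \<noteq> {0}" and X: "spd_on U X" and Y: "spd_on U Y"
    and XY: "spectrally_close U d X Y"
  shows "spectral_distance U X Y \<le> d"
  unfolding spectral_distance_def
proof (rule cSUP_least)
  show "U - {0} \<noteq> {}"
    using U subspace_0[of U] by blast
  fix u assume u: "u \<in> U - {0}"
  have pos: "0 < X u \<bullet> u" "0 < Y u \<bullet> u"
    using X Y u by (auto simp: spd_on_def)
  have "ln (X u \<bullet> u) \<le> ln (exp d * (Y u \<bullet> u))" "ln (Y u \<bullet> u) \<le> ln (exp d * (X u \<bullet> u))"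
    using XY u pos by (auto simp: spectrally_close_def)
  then show "\<bar>ln (X u \<bullet> u) - ln (Y u \<bullet> u)\<bar> \<le> d"
    using pos by (simp add: ln_mult)
qed

section \<open>The two-level operator\<close>

lemma Pi_op:
  fixes U :: "nat \<Rightarrow> 'h::real_inner set"
  assumes U: "finite_dim_subspace (U (Suc j))"
  shows "linear_between UNIV (U (Suc j)) (Pi_op U j)"
    and "Pi_op U j u \<in> U (Suc j)"
    and "w \<in> U (Suc j) \<Longrightarrow> w \<bullet> Pi_op U j u = w \<bullet> u"
    and "norm (Pi_op U j u) \<le> norm u"
proof -
  have I: "linear_between (U (Suc j)) UNIV (\<lambda>w. w)"
    by (simp add: linear_between_def)
  show "linear_between UNIV (U (Suc j)) (Pi_op U j)"
    unfolding Pi_op_def by (rule linear_adjoint_on[OF U I])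
  show m: "Pi_op U j u \<in> U (Suc j)" and p: "\<And>w. w \<in> U (Suc j) \<Longrightarrow> w \<bullet> Pi_op U j u = w \<bullet> u"
    unfolding Pi_op_def by (rule adjoint_on[OF U I]; assumption)+
  \<comment> \<open>Testing the projection with its own value and using Cauchy-Schwarz; one factor
    is then cancelled.\<close>
  have "norm (Pi_op U j u) * norm (Pi_op U j u) \<le> norm (Pi_op U j u) * norm u"
    using p[OF m] norm_cauchy_schwarz[of "Pi_op U j u" u]
    by (simp add: power2_norm_eq_inner[symmetric] power2_eq_square)
  then show "norm (Pi_op U j u) \<le> norm u"
    by (cases "Pi_op U j u = 0") (auto simp: mult_le_cancel_left_pos)
qed

text \<open>The form is block diagonal for the splitting into the coarse space and its orthogonal
  complement: \<open>X\<close> takes coarse values, so it only sees the projection of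
  \<open>v\<close>, and the cross term of the residual vanishes.\<close>

lemma inner_E_op:
  fixes U :: "nat \<Rightarrow> 'h::real_inner set"
  assumes U: "finite_dim_subspace (U (Suc j))" and X: "linear_between (U (Suc j)) (U (Suc j)) X"
  shows "E_op \<beta> U j X u \<bullet> v =
    X (Pi_op U j u) \<bullet> Pi_op U j v + inverse \<beta> * ((u - Pi_op U j u) \<bullet> (v - Pi_op U j v))"
proof -
  note P = Pi_op[where U=U, OF U]
  have "X (Pi_op U j u) \<bullet> v = X (Pi_op U j u) \<bullet> Pi_op U j v"
    using P(3)[OF linear_between_mem[OF X P(2)], of u v] by simp
  moreover have "(u - Pi_op U j u) \<bullet> Pi_op U j v = 0"
    using P(3)[OF P(2), of v u] by (simp add: inner_diff_left inner_diff_right inner_commute[of "Pi_op U j v"])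
  ultimately show ?thesis
    by (simp add: E_op_def inner_add_left inner_diff_right)
qed

lemma spd_on_E_op:
  fixes U :: "nat \<Rightarrow> 'h::real_inner set"
  assumes Uj: "finite_dim_subspace (U j)" and U: "finite_dim_subspace (U (Suc j))"
    and nest: "U (Suc j) \<subseteq> U j" and X: "spd_on (U (Suc j)) X" and \<beta>: "0 < \<beta>"
  shows "spd_on (U j) (E_op \<beta> U j X)"
proof -
  note P = Pi_op[where U=U, OF U]
  note sU = finite_dim_subspace_imp_subspace[OF Uj]
  have lX: "linear_between (U (Suc j)) (U (Suc j)) X"
    and sym: "\<And>u v. u \<in> U (Suc j) \<Longrightarrow> v \<in> U (Suc j) \<Longrightarrow> X u \<bullet> v = u \<bullet> X v"
    using X by (auto simp: spd_on_def)
  note E = inner_E_op[where U=U, OF U lX]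
  note XP = linear_between_compose[OF P(1) lX]
  have mem: "X (Pi_op U j u) \<in> U j" "Pi_op U j u \<in> U j" for u
    using linear_between_mem[OF XP] P(2) nest by blast+
  have "linear_between (U j) (U j) (E_op \<beta> U j X)"
    unfolding linear_between_def E_op_def
    using mem linear_between_add[OF XP] linear_between_scaleR[OF XP]
      linear_between_add[OF P(1)] linear_between_scaleR[OF P(1)]
    by (auto simp: algebra_simps intro!: subspace_add[OF sU] subspace_scale[OF sU] subspace_diff[OF sU])
  moreover have "E_op \<beta> U j X u \<bullet> v = u \<bullet> E_op \<beta> U j X v" for u v
    using E[of \<beta> u v] E[of \<beta> v u] sym[OF P(2) P(2), of u v] by (simp add: inner_commute)
  moreover have "0 < E_op \<beta> U j X u \<bullet> u" if "u \<noteq> 0" for u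
  \<comment> \<open>One block suffices in each case: the residual is \<open>u\<close> itself if the
    projection vanishes, and otherwise the coarse block is already positive.\<close>
  proof (cases "Pi_op U j u = 0")
    case True
    then show ?thesis
      using E[of \<beta> u u] that \<beta> by simp
  next
    case False
    then have "0 < X (Pi_op U j u) \<bullet> Pi_op U j u"
      using X P(2) by (auto simp: spd_on_def)
    then show ?thesis
      using E[of \<beta> u u] \<beta> by (simp add: add_pos_nonneg)
  qed
  ultimately show ?thesis by (simp add: spd_on_def)
qed

text \<open>The coarse blocks inherit the closeness of \<open>X\<close> and \<open>Y\<close>; the
  complementary blocks coincide and are absorbed because \<open>exp d \<ge> 1\<close>.\<close>

lemma spectrally_close_E_op:
  fixes U :: "nat \<Rightarrow> 'h::real_inner set"
  assumes U: "finite_dim_subspace (U (Suc j))"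
    and X: "linear_between (U (Suc j)) (U (Suc j)) X"
    and Y: "linear_between (U (Suc j)) (U (Suc j)) Y"
    and XY: "spectrally_close (U (Suc j)) d X Y" and d: "0 \<le> d" and \<beta>: "0 < \<beta>"
  shows "spectrally_close (U j) d (E_op \<beta> U j X) (E_op \<beta> U j Y)"
proof -
  note P = Pi_op[where U=U, OF U]
  have r: "r \<le> exp d * r" if "0 \<le> r" for r :: real
    using mult_right_mono[of 1 "exp d" r] d that by simp
  have "inverse \<beta> * ((u - Pi_op U j u) \<bullet> (u - Pi_op U j u))
      \<le> exp d * (inverse \<beta> * ((u - Pi_op U j u) \<bullet> (u - Pi_op U j u)))" for u
    using \<beta> by (intro r) simp
  then show ?thesis
    using XY P(2) unfolding spectrally_close_def
    by (simp add: inner_E_op[where U=U, OF U X] inner_E_op[where U=U, OF U Y] distrib_left add_mono)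
qed

text \<open>Order reversal of inversion, from the nonnegativity of the first energy at \<open>v - w / c\<close>.\<close>

lemma energy_inverse_antimono:
  fixes A B :: "'h::real_inner \<Rightarrow> 'k::real_inner"
  assumes U: "subspace U" and A: "linear_between U V A" and B: "linear_between U W B"
    and \<beta>: "0 \<le> \<beta>" and c: "0 < c"
    and le: "\<And>p. p \<in> U \<Longrightarrow> A p \<bullet> A p + \<beta> * (p \<bullet> p) \<le> c * (B p \<bullet> B p + \<beta> * (p \<bullet> p))"
    and v: "v \<in> U" "\<And>q. q \<in> U \<Longrightarrow> A v \<bullet> A q + \<beta> * (v \<bullet> q) = u \<bullet> q"
    and w: "w \<in> U" "\<And>q. q \<in> U \<Longrightarrow> B w \<bullet> B q + \<beta> * (w \<bullet> q) = u \<bullet> q"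
  shows "w \<bullet> u \<le> c * (v \<bullet> u)"
proof -
  define z where "z = inverse c *\<^sub>R w"
  have z: "z \<in> U" using w U by (simp add: z_def subspace_scale)
  have "0 \<le> A (v - z) \<bullet> A (v - z) + \<beta> * ((v - z) \<bullet> (v - z))"
    using \<beta> by simp
  also have "\<dots> = (A v \<bullet> A v + \<beta> * (v \<bullet> v)) - 2 * (A v \<bullet> A z + \<beta> * (v \<bullet> z))
      + (A z \<bullet> A z + \<beta> * (z \<bullet> z))"
    by (simp add: linear_between_diff[OF A U v(1) z] inner_diff_left inner_diff_right
        inner_commute algebra_simps)
  \<comment> \<open>The equation for \<open>v\<close>, tested with \<open>v\<close> and
    \<open>z\<close>, replaces two terms by pairings with \<open>u\<close>; the comparison of
    energies is used only at \<open>z\<close>.\<close>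
  also have "\<dots> \<le> u \<bullet> v - 2 * (u \<bullet> z) + c * (B z \<bullet> B z + \<beta> * (z \<bullet> z))"
    using le[OF z] v z by simp
  also have "c * (B z \<bullet> B z + \<beta> * (z \<bullet> z)) = inverse c * (B w \<bullet> B w + \<beta> * (w \<bullet> w))"
    using c linear_between_scaleR[OF B w(1)] by (simp add: z_def field_simps)
  also have "B w \<bullet> B w + \<beta> * (w \<bullet> w) = u \<bullet> w"
    using w by simp
  finally have "0 \<le> u \<bullet> v - inverse c * (u \<bullet> w)"
    by (simp add: z_def)
  then show ?thesis
    using c by (simp add: field_simps inner_commute)
qed

text \<open>Factor the difference of squares as \<open>(x - y) \<bullet> (x + y)\<close>. Applied
  with \<open>n\<close> the norm of a control and \<open>x\<close>, \<open>y\<close> its fine and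
  coarse states, in either order.\<close>

lemma energy_perturbation:
  fixes x y :: "'k::real_inner" and n a b \<beta> C :: real
  assumes xy: "norm (x - y) \<le> a * n" and x: "norm x \<le> C * n" and y: "norm y \<le> C * n"
    and nonneg: "0 \<le> a" "0 \<le> C" "0 \<le> n" and \<beta>: "0 < \<beta>" and b: "b = 4 * inverse \<beta> * C * a"
  shows "x \<bullet> x + \<beta> * n\<^sup>2 \<le> exp b * (y \<bullet> y + \<beta> * n\<^sup>2)"
proof -
  have b0: "0 \<le> b" using nonneg \<beta> b by simp
  have "x \<bullet> x - y \<bullet> y = (x - y) \<bullet> (x + y)"
    by (simp add: inner_diff_left inner_add_right inner_commute[of y x])
  also have "\<dots> \<le> norm (x - y) * norm (x + y)"
    by (rule norm_cauchy_schwarz)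
  also have "\<dots> \<le> (a * n) * (2 * C * n)"
    using xy x y norm_triangle_ineq[of x y] nonneg by (intro mult_mono) auto
  also have "\<dots> = b / 2 * (\<beta> * n\<^sup>2)"
    using \<beta> b by (simp add: power2_eq_square)
  \<comment> \<open>The regularization term alone already controls \<open>n\<^sup>2\<close>; the
    state term is added since it is nonnegative.\<close>
  also have "\<dots> \<le> b * (y \<bullet> y + \<beta> * n\<^sup>2)"
    using b0 \<beta> by (intro mult_mono) auto
  finally have "x \<bullet> x + \<beta> * n\<^sup>2 \<le> (1 + b) * (y \<bullet> y + \<beta> * n\<^sup>2)"
    by (simp add: algebra_simps)
  also have "\<dots> \<le> exp b * (y \<bullet> y + \<beta> * n\<^sup>2)"
    using \<beta> by (intro mult_right_mono exp_ge_add_one_self) auto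
  finally show ?thesis .
qed

text \<open>Identifies the inverse of the two-level operator in weak form. The projection of
  \<open>v u\<close> is the coarse solution \<open>h\<close>, and the residual of \<open>v u\<close>
  is that of \<open>u\<close> divided by \<open>\<beta>\<close>, which the regularization term
  exactly cancels.\<close>

lemma E_op_G_inv_energy:
  fixes K :: "nat \<Rightarrow> 'h::real_inner \<Rightarrow> 'k::real_inner"
  assumes U: "finite_dim_subspace (U (Suc j))" and K: "linear_between (U (Suc j)) V (K (Suc j))"
    and \<beta>: "0 < \<beta>"
  defines "v \<equiv> \<lambda>u. E_op \<beta> U j (G_inv \<beta> U K (Suc j)) u"
  shows "K (Suc j) (Pi_op U j (v u)) \<bullet> K (Suc j) (Pi_op U j q) + \<beta> * (v u \<bullet> q) = u \<bullet> q"
proof -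
  note P = Pi_op[where U=U, OF U]
  define h where "h = G_inv \<beta> U K (Suc j) (Pi_op U j u)"
  have h: "h \<in> U (Suc j)" "G_op \<beta> U K (Suc j) h = Pi_op U j u"
    unfolding h_def using G_inv[where U=U and K=K, OF U K \<beta> P(2)] by auto
  have "Pi_op U j (v u) = h"
  proof (rule eq_if_inner_eq_on[OF finite_dim_subspace_imp_subspace[OF U] P(2) h(1)])
    fix w assume w: "w \<in> U (Suc j)"
    have "w \<bullet> Pi_op U j (v u) = w \<bullet> v u"
      by (rule P(3)[OF w])
    also have "\<dots> = w \<bullet> h"
      using P(3)[OF w, of u] by (simp add: v_def E_op_def h_def inner_add_right inner_diff_right)
    finally show "w \<bullet> Pi_op U j (v u) = w \<bullet> h" .
  qed
  moreover have "\<beta> * (v u \<bullet> q) = \<beta> * (h \<bullet> Pi_op U j q) + (u \<bullet> q - Pi_op U j u \<bullet> Pi_op U j q)"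
    using \<beta> P(3)[OF h(1), of q] P(3)[OF P(2), of u q]
    by (simp add: v_def E_op_def h_def[symmetric] inner_add_left inner_diff_left field_simps)
  moreover have "K (Suc j) h \<bullet> K (Suc j) (Pi_op U j q) + \<beta> * (h \<bullet> Pi_op U j q) =
      Pi_op U j u \<bullet> Pi_op U j q"
    using inner_G_op[where U=U and K=K, OF U K P(2), of \<beta> h q] h by simp
  ultimately show ?thesis by simp
qed

text \<open>Both operators send \<open>u\<close> to the solution of a weak equation with right-hand
  side \<open>u\<close>, so two-sided closeness of the energies passes to the solutions with the
  roles exchanged.\<close>

lemma spectrally_close_two_level:
  fixes K :: "nat \<Rightarrow> 'h::real_inner \<Rightarrow> 'k::real_inner"
  assumes Uj: "finite_dim_subspace (U j)" and U: "finite_dim_subspace (U (Suc j))"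
    and nest: "U (Suc j) \<subseteq> U j"
    and Kj: "linear_between (U j) V (K j)" and K: "linear_between (U (Suc j)) V' (K (Suc j))"
    and \<beta>: "0 < \<beta>" and a: "0 \<le> a" and C: "0 \<le> C"
    and Cj: "\<And>u. u \<in> U j \<Longrightarrow> norm (K j u) \<le> C * norm u"
    and CS: "\<And>u. u \<in> U (Suc j) \<Longrightarrow> norm (K (Suc j) u) \<le> C * norm u"
    and ab: "\<And>u. u \<in> U j \<Longrightarrow> norm (K j u - K (Suc j) (Pi_op U j u)) \<le> a * norm u"
    and b: "b = 4 * inverse \<beta> * C * a"
  shows "spectrally_close (U j) b (E_op \<beta> U j (G_inv \<beta> U K (Suc j))) (G_inv \<beta> U K j)"
  unfolding spectrally_close_def
proof (intro ballI)
  fix u assume u: "u \<in> U j"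
  note P = Pi_op[where U=U, OF U]
  note sU = finite_dim_subspace_imp_subspace[OF Uj]
  let ?A = "\<lambda>u. K (Suc j) (Pi_op U j u)"
  let ?v = "E_op \<beta> U j (G_inv \<beta> U K (Suc j)) u" and ?w = "G_inv \<beta> U K j u"
  have A: "linear_between (U j) V' ?A"
    using linear_between_compose[OF P(1) K] by (rule linear_between_subset) auto
  have CA: "norm (?A p) \<le> C * norm p" for p
    using CS[OF P(2)] mult_left_mono[OF P(4) C] order_trans by blast
  have le: "?A p \<bullet> ?A p + \<beta> * (p \<bullet> p) \<le> exp b * (K j p \<bullet> K j p + \<beta> * (p \<bullet> p))"
    "K j p \<bullet> K j p + \<beta> * (p \<bullet> p) \<le> exp b * (?A p \<bullet> ?A p + \<beta> * (p \<bullet> p))" if p: "p \<in> U j" for p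
    using energy_perturbation[OF _ CA Cj[OF p] a C norm_ge_zero \<beta> b]
      energy_perturbation[OF ab[OF p] Cj[OF p] CA a C norm_ge_zero \<beta> b] ab[OF p]
    by (auto simp: norm_minus_commute power2_norm_eq_inner)
  have v: "?v \<in> U j"
    using spd_on_E_op[where U=U, OF Uj U nest spd_on_G_inv[where U=U and K=K, OF U K \<beta>] \<beta>] u
    by (auto simp: spd_on_def intro: linear_between_mem)
  note ve = E_op_G_inv_energy[where U=U and K=K, OF U K \<beta>]
  have w: "?w \<in> U j" by (rule G_inv(1)[where U=U and K=K, OF Uj Kj \<beta> u])
  have we: "K j ?w \<bullet> K j q + \<beta> * (?w \<bullet> q) = u \<bullet> q" if "q \<in> U j" for q
    using inner_G_op[where U=U and K=K, OF Uj Kj that, of \<beta> ?w] G_inv(2)[where U=U and K=K, OF Uj Kj \<beta> u] by simp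
  show "?v \<bullet> u \<le> exp b * (?w \<bullet> u) \<and> ?w \<bullet> u \<le> exp b * (?v \<bullet> u)"
    using energy_inverse_antimono[OF sU A Kj less_imp_le[OF \<beta>] exp_gt_zero le(1) v ve w we]
      energy_inverse_antimono[OF sU Kj A less_imp_le[OF \<beta>] exp_gt_zero le(2) w we v ve]
    by blast
qed

section \<open>The Newton step\<close>

text \<open>By convexity it is enough to check the endpoint \<open>7 / 20\<close>, where the line
  has the value \<open>23 / 16\<close>.\<close>

lemma exp_le_chord:
  fixes d :: real
  assumes "0 \<le> d" "d \<le> 7 / 20"
  shows "exp d \<le> 1 + 5 / 4 * d"
proof -
  \<comment> \<open>The twentieth power makes the exponent an integer, so that a decimal bound for
    \<open>exp 1\<close> decides the endpoint inequality.\<close>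
  have "exp 7 = exp (1::real) ^ 7"
    using exp_of_nat_mult[of 7 "1::real"] by simp
  also have "\<dots> \<le> (272 / 100) ^ 7"
    using e_less_272 by (intro power_mono) auto
  also have "\<dots> \<le> (23 / 16) ^ 20"
    by (simp add: power_divide divide_le_eq)
  finally have "exp (7 / 20 :: real) ^ 20 \<le> (23 / 16) ^ 20"
    using exp_of_nat_mult[of 20 "7 / 20 :: real"] by simp
  then have e: "exp (7 / 20 :: real) \<le> 23 / 16"
    by (rule power_le_imp_le_base[where n = 19, simplified]) simp
  have "exp ((1 - 20 / 7 * d) *\<^sub>R 0 + (20 / 7 * d) *\<^sub>R (7 / 20))
      \<le> (1 - 20 / 7 * d) * exp 0 + (20 / 7 * d) * exp (7 / 20)"
    using assms by (intro convex_onD[OF exp_convex]) auto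
  also have "\<dots> \<le> (1 - 20 / 7 * d) * exp 0 + (20 / 7 * d) * (23 / 16)"
    using assms e by (intro add_left_mono mult_left_mono) auto
  finally show ?thesis by simp
qed

text \<open>
  A symmetric form dominated on the diagonal by \<open>\<eta> (H u, u)\<close> has operator norm at most \<open>\<eta>\<close>
  for the inner product of \<open>H\<close>; the proof polarizes at \<open>u\<close> and multiples of \<open>G (D u)\<close>.
\<close>

lemma energy_norm_le_numerical_radius:
  fixes G H D :: "'h::real_inner \<Rightarrow> 'h"
  assumes U: "subspace U" and G: "linear_between U U G"
    and H: "linear_between U U H" "\<And>u v. u \<in> U \<Longrightarrow> v \<in> U \<Longrightarrow> H u \<bullet> v = u \<bullet> H v"
    and HG: "\<And>u. u \<in> U \<Longrightarrow> H (G u) = u"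
    and D: "linear_between U U D" "\<And>u v. u \<in> U \<Longrightarrow> v \<in> U \<Longrightarrow> D u \<bullet> v = u \<bullet> D v"
    and bound: "\<And>u. u \<in> U \<Longrightarrow> \<bar>D u \<bullet> u\<bar> \<le> \<eta> * (H u \<bullet> u)" and \<eta>: "0 \<le> \<eta>"
    and u: "u \<in> U"
  shows "G (D u) \<bullet> D u \<le> \<eta>\<^sup>2 * (H u \<bullet> u)"
proof -
  define v where "v = G (D u)"
  define s where "s = v \<bullet> D u"
  have v: "v \<in> U"
    unfolding v_def using linear_between_mem[OF G] linear_between_mem[OF D(1)] u by blast
  have Hv: "H v = D u"
    unfolding v_def using HG linear_between_mem[OF D(1) u] by blast
  \<comment> \<open>Adding the upper bound at \<open>u + t v\<close> to the lower bound at
    \<open>u - t v\<close> leaves only the cross terms of \<open>D\<close> and the diagonal terms of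
    \<open>H\<close>; both \<open>D v \<bullet> u\<close> and \<open>H v \<bullet> v\<close> equal
    \<open>s\<close>.\<close>
  have *: "4 * t * s \<le> 2 * \<eta> * (H u \<bullet> u + t\<^sup>2 * s)" for t
  proof -
    have tv: "t *\<^sub>R v \<in> U" using v U by (simp add: subspace_scale)
    have D': "D (u + t *\<^sub>R v) = D u + t *\<^sub>R D v" "D (u - t *\<^sub>R v) = D u - t *\<^sub>R D v"
      "H (u + t *\<^sub>R v) = H u + t *\<^sub>R H v" "H (u - t *\<^sub>R v) = H u - t *\<^sub>R H v"
      using linear_between_add[OF D(1) u tv] linear_between_diff[OF D(1) U u tv]
        linear_between_add[OF H(1) u tv] linear_between_diff[OF H(1) U u tv]
        linear_between_scaleR[OF D(1) v] linear_between_scaleR[OF H(1) v] by auto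
    have Dvu: "D v \<bullet> u = s"
      using D(2)[OF v u] by (simp add: s_def)
    have "D (u + t *\<^sub>R v) \<bullet> (u + t *\<^sub>R v) \<le> \<eta> * (H (u + t *\<^sub>R v) \<bullet> (u + t *\<^sub>R v))"
      "- (D (u - t *\<^sub>R v) \<bullet> (u - t *\<^sub>R v)) \<le> \<eta> * (H (u - t *\<^sub>R v) \<bullet> (u - t *\<^sub>R v))"
      using bound[OF subspace_add[OF U u tv]] bound[OF subspace_diff[OF U u tv]] by auto
    from add_mono[OF this] show ?thesis
      unfolding D' using Dvu Hv
      by (simp add: inner_simps s_def inner_commute power2_eq_square algebra_simps)
  qed
  have "s \<le> \<eta>\<^sup>2 * (H u \<bullet> u)"
  proof (cases "\<eta> = 0")
    case True
    then show ?thesis using *[of 1] by simp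
  next
    case False
    then have "0 < \<eta>" using \<eta> by simp
    \<comment> \<open>This \<open>t\<close> maximizes the coefficient
      \<open>4 t - 2 \<eta> t\<^sup>2\<close> of \<open>s\<close>.\<close>
    with *[of "1 / \<eta>"] show ?thesis
      by (simp add: field_simps power2_eq_square)
  qed
  then show ?thesis by (simp add: s_def v_def)
qed

text \<open>The error after the step is a nonnegative form, so the new operator lies below
  \<open>H\<close>, and only the lower bound costs anything: a factor
  \<open>1 - \<eta>\<^sup>2\<close> with \<open>\<eta> = exp d - 1\<close>. The radius
  \<open>7 / 20\<close> is \<open>1 / 4 + 1 / 10\<close>, the largest that the recursion
  produces.\<close>

lemma spectrally_close_N_op:
  fixes G H Y :: "'h::real_inner \<Rightarrow> 'h"
  assumes U: "subspace U" and G: "spd_on U G" and H: "spd_on U H"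
    and GH: "\<And>u. u \<in> U \<Longrightarrow> G (H u) = u"
    and Y: "spd_on U Y" and YH: "spectrally_close U d Y H" and d: "0 \<le> d" "d \<le> 7 / 20"
  shows "spd_on U (N_op G Y)" "spectrally_close U (2 * d\<^sup>2) (N_op G Y) H"
proof -
  have lG: "linear_between U U G" and lH: "linear_between U U H" and lY: "linear_between U U Y"
    using G H Y by (auto simp: spd_on_def)
  have symG: "\<And>u v. u \<in> U \<Longrightarrow> v \<in> U \<Longrightarrow> G u \<bullet> v = u \<bullet> G v"
    and symH: "\<And>u v. u \<in> U \<Longrightarrow> v \<in> U \<Longrightarrow> H u \<bullet> v = u \<bullet> H v"
    and symY: "\<And>u v. u \<in> U \<Longrightarrow> v \<in> U \<Longrightarrow> Y u \<bullet> v = u \<bullet> Y v"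
    using G H Y by (auto simp: spd_on_def)
  note mem = linear_between_mem[OF lG] linear_between_mem[OF lH] linear_between_mem[OF lY]
  have HG: "H (G u) = u" if "u \<in> U" for u
    by (rule inj_onD[OF spd_on_inj[OF U G]]) (use that GH mem in auto)
  define D where "D u = Y u - H u" for u
  define \<eta> where "\<eta> = exp d - 1"
  have \<eta>: "0 \<le> \<eta>" "\<eta> \<le> 5 / 4 * d"
    using d exp_le_chord[OF d] by (auto simp: \<eta>_def)
  have D: "linear_between U U D"
    using mem linear_between_add[OF lY] linear_between_add[OF lH]
      linear_between_scaleR[OF lY] linear_between_scaleR[OF lH] U
    by (auto simp: linear_between_def D_def algebra_simps intro!: subspace_diff)
  have symD: "D u \<bullet> v = u \<bullet> D v" if "u \<in> U" "v \<in> U" for u v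
    using symY[OF that] symH[OF that] by (simp add: D_def inner_diff_left inner_diff_right)
  have bound: "\<bar>D u \<bullet> u\<bar> \<le> \<eta> * (H u \<bullet> u)" if u: "u \<in> U" for u
  proof -
    have h: "Y u \<bullet> u \<le> exp d * (H u \<bullet> u)" "H u \<bullet> u \<le> exp d * (Y u \<bullet> u)"
      using YH u by (auto simp: spectrally_close_def)
    \<comment> \<open>If \<open>Y\<close> is below \<open>H\<close> at \<open>u\<close>, closeness
      gives \<open>H - Y \<le> \<eta> Y\<close> there, and this inequality replaces
      \<open>\<eta> Y\<close> by \<open>\<eta> H\<close>.\<close>
    have "\<eta> * (H u \<bullet> u - Y u \<bullet> u) \<ge> 0" if "Y u \<bullet> u \<le> H u \<bullet> u"
      using \<eta> that by simp
    with h show ?thesis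
      by (auto simp: D_def inner_diff_left abs_if \<eta>_def algebra_simps)
  qed
  have N: "N_op G Y u \<bullet> u = H u \<bullet> u - G (D u) \<bullet> D u" if u: "u \<in> U" for u
  proof -
    have "G (D u) = G (Y u) - u"
      using linear_between_diff[OF lG U] mem u GH by (simp add: D_def)
    moreover have "G (Y u) \<bullet> H u = Y u \<bullet> u"
      using symG[of "Y u" "H u"] mem u GH by simp
    moreover have "Y (G (Y u)) \<bullet> u = G (Y u) \<bullet> Y u"
      using symY[of "G (Y u)" u] mem u by simp
    ultimately show ?thesis
      by (simp add: N_op_def D_def inner_simps inner_commute[of u])
  qed
  have upper: "N_op G Y u \<bullet> u \<le> H u \<bullet> u" if u: "u \<in> U" for u
    using N[OF u] spd_on_nonneg[OF G linear_between_mem[OF D u]] by simp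
  have lower: "(1 - \<eta>\<^sup>2) * (H u \<bullet> u) \<le> N_op G Y u \<bullet> u" if u: "u \<in> U" for u
    using N[OF u] energy_norm_le_numerical_radius[OF U lG lH symH HG D symD bound \<eta>(1) u]
    by (simp add: algebra_simps)
  have "\<eta>\<^sup>2 \<le> (5 / 4 * d)\<^sup>2" using \<eta> by (intro power_mono)
  then have \<eta>2: "\<eta>\<^sup>2 \<le> 25 / 16 * d\<^sup>2" by (simp add: power_mult_distrib power_divide)
  have "d\<^sup>2 \<le> (7 / 20)\<^sup>2" using d by (intro power_mono)
  then have d2: "d\<^sup>2 \<le> 49 / 400" by (simp add: power_divide)
  have lN: "linear_between U U (N_op G Y)"
    using mem linear_between_add[OF lY] linear_between_add[OF lG]
      linear_between_scaleR[OF lY] linear_between_scaleR[OF lG] U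
    by (auto simp: linear_between_def N_op_def algebra_simps intro!: subspace_diff subspace_scale)
  moreover have "N_op G Y u \<bullet> v = u \<bullet> N_op G Y v" if u: "u \<in> U" and v: "v \<in> U" for u v
    using symY[OF u v] symY[of "G (Y u)" v] symG[of "Y u" "Y v"] symY[of u "G (Y v)"] mem u v
    by (simp add: N_op_def inner_diff_left inner_diff_right)
  moreover have "0 < N_op G Y u \<bullet> u" if u: "u \<in> U" "u \<noteq> 0" for u
  proof -
    have "0 < (1 - \<eta>\<^sup>2) * (H u \<bullet> u)"
      using H u \<eta>2 d2 by (intro mult_pos_pos) (auto simp: spd_on_def)
    with lower[OF u(1)] show ?thesis by simp
  qed
  ultimately show spdN: "spd_on U (N_op G Y)"
    by (simp add: spd_on_def)
  have "1 \<le> (1 + 2 * d\<^sup>2) * (1 - 25 / 16 * d\<^sup>2)"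
  proof -
    \<comment> \<open>This product is the excess of the right-hand side over 1;
      \<open>7 / 16\<close> is \<open>2 - 25 / 16\<close>, the gap between the claimed factor 2 and
      the squared chord slope.\<close>
    have "0 \<le> d\<^sup>2 * (7 / 16 - 25 / 8 * d\<^sup>2)" using d2 by (intro mult_nonneg_nonneg) auto
    then show ?thesis by (simp add: algebra_simps)
  qed
  also have "\<dots> \<le> exp (2 * d\<^sup>2) * (1 - \<eta>\<^sup>2)"
    using \<eta>2 d2 by (intro mult_mono exp_ge_add_one_self) auto
  finally have e: "1 \<le> exp (2 * d\<^sup>2) * (1 - \<eta>\<^sup>2)" .
  show "spectrally_close U (2 * d\<^sup>2) (N_op G Y) H"
    unfolding spectrally_close_def
  proof (intro ballI conjI)
    fix u assume u: "u \<in> U"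
    note H0 = spd_on_nonneg[OF H u]
    show "N_op G Y u \<bullet> u \<le> exp (2 * d\<^sup>2) * (H u \<bullet> u)"
      using upper[OF u] mult_right_mono[OF _ H0, of 1 "exp (2 * d\<^sup>2)"] by simp
    have "H u \<bullet> u \<le> exp (2 * d\<^sup>2) * (1 - \<eta>\<^sup>2) * (H u \<bullet> u)"
      using mult_right_mono[OF e H0] by simp
    also have "\<dots> \<le> exp (2 * d\<^sup>2) * (N_op G Y u \<bullet> u)"
      using lower[OF u] by (simp add: mult.assoc)
    finally show "H u \<bullet> u \<le> exp (2 * d\<^sup>2) * (N_op G Y u \<bullet> u)" .
  qed
qed

section \<open>The multilevel recursion\<close>

theorem theorem2:
  fixes \<Omega> :: "(real ^ 'd) set"
    and \<kappa> :: "real ^ 'd \<Rightarrow> real"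
    and \<kappa>0 \<kappa>1 \<beta> C\<^sub>K f KK :: real
    and l :: nat
    and Y U :: "nat \<Rightarrow> (real ^ 'd, real) L2 set"
    and K :: "nat \<Rightarrow> (real ^ 'd, real) L2 \<Rightarrow> (real ^ 'd, real) L2"
    and a b :: "nat \<Rightarrow> real"
  assumes dim: "CARD('d) = 2 \<or> CARD('d) = 3"
    and domain: "open \<Omega>" "connected \<Omega>" "bounded \<Omega>" "\<Omega> \<noteq> {}"
    and coeff_meas: "\<kappa> \<in> borel_measurable (lebesgue_on \<Omega>)"
    and coeff_bounds: "0 < \<kappa>0" "\<And>x. x \<in> \<Omega> \<Longrightarrow> \<kappa>0 \<le> \<kappa> x \<and> \<kappa> x \<le> \<kappa>1"
    and levels: "2 \<le> l"
    and beta: "0 < \<beta>"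
    and state_spaces: "\<And>j. j < l \<Longrightarrow> finite_dim_subspace (Y j) \<and> Y j \<noteq> {0} \<and> Y j \<subseteq> H1_0 \<Omega>"
    and control_spaces: "\<And>j. j < l \<Longrightarrow> finite_dim_subspace (U j) \<and> U j \<noteq> {0} \<and> U j \<subseteq> L2_on \<Omega>"
    and nested: "\<And>j. Suc j < l \<Longrightarrow> Y (Suc j) \<subseteq> Y j \<and> U (Suc j) \<subseteq> U j"
    and solution: "\<And>j. j < l \<Longrightarrow> is_solution_operator \<Omega> \<kappa> (U j) (Y j) (K j)"
    and C_pos: "0 < C\<^sub>K"
    and K_bound: "\<And>j. j < l \<Longrightarrow> op_norm (U j) (K j) \<le> C\<^sub>K"
    and a_eq: "\<And>j. j \<le> l - 2 \<Longrightarrow>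
           a j = op_norm (U j) (\<lambda>u. K j u - K (Suc j) (Pi_op U j u))"
    and b_eq: "\<And>j. j \<le> l - 2 \<Longrightarrow> b j = 4 * inverse \<beta> * C\<^sub>K * a j"
    and f_bounds: "0 < f" "f \<le> 1"
    and KK_bound: "KK \<le> min (1 / 10) (f / 8)"
    and b_bound: "\<And>j. j \<le> l - 2 \<Longrightarrow> b j \<le> KK * f ^ (l - 1 - j)"
  shows "spd_on (U 0) (W_op l \<beta> U K 0) \<and>
         spectral_distance (U 0) (W_op l \<beta> U K 0) (G_inv \<beta> U K 0) \<le> (1 / 4 + KK) * f ^ (l - 1)"
proof -
  let ?G = "G_op \<beta> U K" and ?H = "G_inv \<beta> U K" and ?W = "W_op l \<beta> U K"
  have U: "finite_dim_subspace (U j)" "U j \<noteq> {0}" if "j < l" for j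
    using control_spaces[OF that] by auto
  have K: "linear_between (U j) (Y j) (K j)" if "j < l" for j
    using solution[OF that] by (auto simp: is_solution_operator_def)
  note G = spd_on_G_op[where U=U and K=K, OF U(1) K beta]
  note H = spd_on_G_inv[where U=U and K=K, OF U(1) K beta]
  have b_nonneg: "0 \<le> b j" and two_level: "spectrally_close (U j) (b j) (E_op \<beta> U j (?H (Suc j))) (?H j)"
    if j: "Suc j < l" for j
  proof -
    have j': "j < l" "j \<le> l - 2" using j by auto
    note P = Pi_op[where U=U, OF U(1)[OF j]]
    \<comment> \<open>Linearity makes the supremum defining \<open>a j\<close> a genuine bound for
      the consistency error.\<close>
    have lin: "linear_between (U j) UNIV (\<lambda>u. K j u - K (Suc j) (Pi_op U j u))"
      using linear_between_add[OF K[OF j'(1)]] linear_between_scaleR[OF K[OF j'(1)]]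
        linear_between_add[OF linear_between_compose[OF P(1) K[OF j]]]
        linear_between_scaleR[OF linear_between_compose[OF P(1) K[OF j]]]
      by (auto simp: linear_between_def algebra_simps)
    have a: "0 \<le> a j"
      using op_norm_nonneg[OF U(1,2)[OF j'(1)] lin] a_eq[OF j'(2)] by simp
    then show "0 \<le> b j"
      using b_eq[OF j'(2)] beta C_pos by simp
    have C: "norm (K i u) \<le> C\<^sub>K * norm u" if "i < l" "u \<in> U i" for i u
      using norm_le_op_norm[OF U(1) K that(2)] that mult_right_mono[OF K_bound norm_ge_zero]
      by (meson order_trans)
    show "spectrally_close (U j) (b j) (E_op \<beta> U j (?H (Suc j))) (?H j)"
      by (rule spectrally_close_two_level[where U=U and K=K and V="Y j" and V'="Y (Suc j)" and a="a j" and C="C\<^sub>K"])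
        (use U K C j j' a beta C_pos nested norm_le_op_norm[OF U(1)[OF j'(1)] lin]
          a_eq[OF j'(2)] b_eq[OF j'(2)] in auto)
  qed
  \<comment> \<open>The passage from level \<open>j + 1\<close> to level \<open>j\<close> before any
    Newton step; it serves the induction and also the finest level.\<close>
  have E: "spd_on (U j) (E_op \<beta> U j X) \<and> spectrally_close (U j) (d + b j) (E_op \<beta> U j X) (?H j)"
    if j: "Suc j < l" and X: "spd_on (U (Suc j)) X"
      and d: "spectrally_close (U (Suc j)) d X (?H (Suc j))" "0 \<le> d" for j X d
  proof
    have j': "j < l" using j by auto
    show "spd_on (U j) (E_op \<beta> U j X)"
      using nested[OF j] by (intro spd_on_E_op U j j' X beta) auto
    have "spectrally_close (U j) d (E_op \<beta> U j X) (E_op \<beta> U j (?H (Suc j)))"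
      using X H[OF j j] by (intro spectrally_close_E_op U j d beta) (auto simp: spd_on_def)
    then show "spectrally_close (U j) (d + b j) (E_op \<beta> U j X) (?H j)"
      using two_level[OF j] by (rule spectrally_close_trans)
  qed
  have f_pow: "0 < f ^ n" "f ^ n \<le> 1" for n
    using f_bounds by (auto simp: power_le_one)
  have "spd_on (U 1) (?W 1) \<and> spectrally_close (U 1) (1 / 4 * f ^ (l - 1)) (?W 1) (?H 1)"
  \<comment> \<open>Induction descends from the coarsest level and stops at 1, since level 0 has no
    Newton step. At level \<open>j\<close> the exponent is \<open>l - j\<close>.\<close>
  proof (rule inc_induct[where i = 1 and j = "l - 1"])
    show "1 \<le> l - 1" using levels by simp
    have "?W (l - 1) = ?H (l - 1)"
      by (subst W_op.simps) simp
    moreover have "l - 1 < l" using levels by simp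
    ultimately show "spd_on (U (l - 1)) (?W (l - 1)) \<and>
        spectrally_close (U (l - 1)) (1 / 4 * f ^ (l - (l - 1))) (?W (l - 1)) (?H (l - 1))"
      \<comment> \<open>The coarsest operator is exact, hence close to the inverse at every
        nonnegative radius.\<close>
      using H[of "l - 1"] f_bounds by (auto intro!: spectrally_close_refl)
  next
    fix j assume j: "1 \<le> j" "j < l - 1"
      and IH: "spd_on (U (Suc j)) (?W (Suc j)) \<and>
        spectrally_close (U (Suc j)) (1 / 4 * f ^ (l - Suc j)) (?W (Suc j)) (?H (Suc j))"
    let ?d = "1 / 4 * f ^ (l - Suc j) + b j"
    have jl: "Suc j < l" "j < l" "j \<le> l - 2" using j by auto
    have W: "?W j = N_op (?G j) (E_op \<beta> U j (?W (Suc j)))"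
      using j by (subst W_op.simps) auto
    have *: "spd_on (U j) (E_op \<beta> U j (?W (Suc j)))"
      "spectrally_close (U j) ?d (E_op \<beta> U j (?W (Suc j))) (?H j)"
      using E[OF jl(1), of "?W (Suc j)" "1 / 4 * f ^ (l - Suc j)"] IH f_pow(1)[of "l - Suc j"] by auto
    have "b j \<le> KK * f ^ (l - Suc j)"
      using b_bound[OF jl(3)] by simp
    also have "\<dots> \<le> 1 / 10 * f ^ (l - Suc j)"
      using KK_bound f_pow(1)[of "l - Suc j"] by (intro mult_right_mono) auto
    finally have d: "0 \<le> ?d" "?d \<le> 7 / 20 * f ^ (l - Suc j)"
      using b_nonneg[OF jl(1)] f_pow(1)[of "l - Suc j"] by auto
    then have d': "?d \<le> 7 / 20" using f_pow(2)[of "l - Suc j"] by simp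
    note N = spectrally_close_N_op[OF finite_dim_subspace_imp_subspace[OF U(1)[OF jl(2)]]
        G[OF jl(2,2)] H[OF jl(2,2)] G_inv(2)[where U=U and K=K, OF U(1)[OF jl(2)] K[OF jl(2)] beta] * d(1) d']
    have "2 * ?d\<^sup>2 \<le> 2 * (7 / 20 * f ^ (l - Suc j))\<^sup>2"
      using d by (intro mult_left_mono power_mono) auto
    also have "\<dots> = 49 / 200 * f ^ ((l - Suc j) * 2)"
      by (simp add: power_mult_distrib power_divide power_mult)
    \<comment> \<open>Since \<open>l - j \<ge> 2\<close>, doubling \<open>l - j - 1\<close> gives at
      least \<open>l - j\<close>, and powers of \<open>f \<le> 1\<close> decrease; squaring thus
      restores both the exponent and the constant \<open>1 / 4\<close>.\<close>
    also have "\<dots> \<le> 1 / 4 * f ^ (l - j)"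
      using j f_bounds f_pow(1) by (intro mult_mono power_decreasing) (auto simp: less_imp_le)
    finally show "spd_on (U j) (?W j) \<and> spectrally_close (U j) (1 / 4 * f ^ (l - j)) (?W j) (?H j)"
      unfolding W using N H[OF jl(2,2)] spectrally_close_mono by blast
  qed
  then have W: "spd_on (U 0) (E_op \<beta> U 0 (?W 1))"
    "spectrally_close (U 0) (1 / 4 * f ^ (l - 1) + b 0) (E_op \<beta> U 0 (?W 1)) (?H 0)"
    using E[of 0 "?W 1" "1 / 4 * f ^ (l - 1)"] levels f_pow(1)[of "l - 1"] by auto
  have W0: "?W 0 = E_op \<beta> U 0 (?W 1)"
    using levels by (subst W_op.simps) auto
  have l: "0 < l" using levels by simp
  have "spectral_distance (U 0) (?W 0) (?H 0) \<le> 1 / 4 * f ^ (l - 1) + b 0"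
    unfolding W0
    by (rule spectral_distance_le[OF finite_dim_subspace_imp_subspace[OF U(1)[OF l]] U(2)[OF l]
          W(1) H[OF l l] W(2)])
  also have "\<dots> \<le> (1 / 4 + KK) * f ^ (l - 1)"
    using b_bound[of 0] by (simp add: algebra_simps)
  finally show ?thesis
    using W(1) W0 by simp
qed

end
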